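(* Let $X$ be a real normed linear space, let $n\ge2$, let $\Omega_0\subseteq X$ be a nonempty closed convex set, let $\Omega_1,\dots,\Omega_n\subseteq X$ be nonempty closed strictly convex sets, and let $v_1,\dots,v_n\in X$ be nonzero vectors. Suppose that for all $x,y\in\Omega_0$ with $x\ne y$ there are at least two indices $i\in\{1,\dots,n\}$ such that $[x,y]\cap\Omega_i=\emptyset$. Suppose further that for all $i\ne j$ the vectors $v_i,v_j$ are linearly independent. Then the optimization problem $$\text{minimize } S(x):=\sum_{i=1}^nT_{v_i}(x;\Omega_i)\quad\text{subject to }x\in\Omega_0$$ has at most one optimal solution.
   Context: For a nonempty closed set $\Omega\subseteq X$ and nonzero $v\in X$, $T_v(x;\Omega):=\inf\{t\ge0\mid x+tv\in\Omega\}\in[0,\infty]$, with $\inf\emptyset=\infty$. $[x,y]:=\{tx+(1-t)y\mid t\in[0,1]\}$. A set $\Omega$ is strictly convex if for any $x_1,x_2\in\Omega$ with $x_1\ne x_2$ and any $t\in(0,1)$, $tx_1+(1-t)x_2\in\operatorname{int}\Omega$. An optimal solution is a point $\bar x\in\Omega_0$ with $S(\bar x)<\infty$ and $S(\bar x)\le S(x)$ for all $x\in\Omega_0$. *)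

theory Defs
  imports "HOL-Analysis.Analysis"
begin

(* T_v(x; \<Omega>). In ereal, Inf {} = \<infinity>, which is the convention inf \<emptyset> = \<infinity>. *)
definition directional_min_time :: "'a::real_normed_vector \<Rightarrow> 'a set \<Rightarrow> 'a \<Rightarrow> ereal" where
  "directional_min_time v \<Omega> x = Inf (ereal ` {t. 0 \<le> t \<and> x + t *\<^sub>R v \<in> \<Omega>})"

(* The interior is taken in the whole space, so a set with empty interior is strictly convex
   only if it has at most one point. *)
definition strictly_convex :: "'a::real_normed_vector set \<Rightarrow> bool" where
  "strictly_convex \<Omega> \<longleftrightarrow>
    (\<forall>x\<in>\<Omega>. \<forall>y\<in>\<Omega>. x \<noteq> y \<longrightarrow> (\<forall>t\<in>{0<..<1}. t *\<^sub>R x + (1 - t) *\<^sub>R y \<in> interior \<Omega>))"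

definition optimal_solution :: "('a \<Rightarrow> ereal) \<Rightarrow> 'a set \<Rightarrow> 'a \<Rightarrow> bool" where
  "optimal_solution S C x \<longleftrightarrow> x \<in> C \<and> S x < \<infinity> \<and> (\<forall>y\<in>C. S x \<le> S y)"

(* Linear independence of u, v as a family: independent {u, v} alone also holds
   for u = v \<noteq> 0, since {u, v} is then a singleton. *)
definition lin_indep_pair :: "'a::real_vector \<Rightarrow> 'a \<Rightarrow> bool" where
  "lin_indep_pair u v \<longleftrightarrow> u \<noteq> v \<and> independent {u, v}"

end

theory Submission
  imports Defs
begin

text \<open>
  At the midpoint \<open>m\<close> of two distinct optimal solutions \<open>x\<close>, \<open>y\<close>, convexity of \<open>\<Omega> i\<close> gives
  \<open>T i m \<le> (T i x + T i y) / 2\<close>. Of the two sets that miss the segment from \<open>x\<close> to \<open>y\<close>, at least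
  one has a direction \<open>v k\<close> not parallel to \<open>x - y\<close>. For this \<open>k\<close> the points at which \<open>x\<close> and \<open>y\<close>
  hit \<open>\<Omega> k\<close> are distinct, so their midpoint is interior to \<open>\<Omega> k\<close>. As \<open>m\<close> itself is not in \<open>\<Omega> k\<close>,
  \<open>m\<close> hits \<open>\<Omega> k\<close> strictly earlier than that midpoint, and the objective drops strictly.
\<close>

lemma directional_min_time_nonneg: "0 \<le> directional_min_time v \<Omega> x"
  unfolding directional_min_time_def by (auto intro: Inf_greatest)

lemma directional_min_time_le:
  assumes "0 \<le> t" and "x + t *\<^sub>R v \<in> \<Omega>"
  shows "directional_min_time v \<Omega> x \<le> ereal t"
  unfolding directional_min_time_def using assms by (auto intro: Inf_lower)

text \<open>The admissible times form a closed set of reals bounded below by 0, and finiteness makes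
  it nonempty, so its infimum is a minimum.\<close>

lemma directional_min_time_attained:
  assumes "closed \<Omega>" and fin: "directional_min_time v \<Omega> x < \<infinity>"
  obtains a where "0 \<le> a" "directional_min_time v \<Omega> x = ereal a" "x + a *\<^sub>R v \<in> \<Omega>"
proof -
  let ?A = "{t. 0 \<le> t \<and> x + t *\<^sub>R v \<in> \<Omega>}"
  have "closed ((\<lambda>t. x + t *\<^sub>R v) -` \<Omega>)"
    by (intro closed_vimage assms continuous_intros)
  then have "closed ({0..} \<inter> (\<lambda>t. x + t *\<^sub>R v) -` \<Omega>)"
    by (intro closed_Int closed_atLeast)
  moreover have "{0..} \<inter> (\<lambda>t. x + t *\<^sub>R v) -` \<Omega> = ?A"
    by auto
  ultimately have cl: "closed ?A"
    by simp
  have ne: "?A \<noteq> {}"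
    using fin unfolding directional_min_time_def by (intro notI) (simp add: top_ereal_def)
  have bdd: "bdd_below ?A"
    by (rule bdd_belowI[of _ 0]) auto
  have mem: "Inf ?A \<in> ?A"
    by (rule closed_contains_Inf[OF ne bdd cl])
  \<comment> \<open>\<open>Inf ?A\<close> lies in \<open>?A\<close>, so it is a least element, and
    \<open>ereal\<close> preserves the order.\<close>
  have "Inf (ereal ` ?A) = ereal (Inf ?A)"
    using mem by (intro Inf_eqI) (auto intro!: cInf_lower bdd)
  then show thesis
    using mem by (intro that[of "Inf ?A"]) (auto simp: directional_min_time_def)
qed

text \<open>An interior hit leaves room to stop slightly earlier. Since \<open>x\<close> is outside
  \<open>\<Omega>\<close>, the hit is not at time 0, so an earlier nonnegative time exists.\<close>

lemma directional_min_time_less: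
  assumes "x + s *\<^sub>R v \<in> interior \<Omega>" and "0 \<le> s" and "x \<notin> \<Omega>"
  shows "directional_min_time v \<Omega> x < ereal s"
proof -
  have "s \<noteq> 0"
    using assms interior_subset by force
  with \<open>0 \<le> s\<close> have "0 < s"
    by simp
  have "open ((\<lambda>t. x + t *\<^sub>R v) -` interior \<Omega>)"
    by (intro open_vimage open_interior continuous_intros)
  moreover have "s \<in> (\<lambda>t. x + t *\<^sub>R v) -` interior \<Omega>"
    using assms by simp
  ultimately obtain e where e: "0 < e" "ball s e \<subseteq> (\<lambda>t. x + t *\<^sub>R v) -` interior \<Omega>"
    by (meson openE)
  \<comment> \<open>Going back by \<open>e / 2\<close> stays inside the ball; the cap
    \<open>s\<close> keeps \<open>t\<close> nonnegative.\<close>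
  define t where "t = s - min (e / 2) s"
  have "t \<in> ball s e" "0 \<le> t" "t < s"
    using e \<open>0 < s\<close> by (auto simp: t_def dist_real_def)
  then have "x + t *\<^sub>R v \<in> \<Omega>"
    using e interior_subset by blast
  then have "directional_min_time v \<Omega> x \<le> ereal t"
    by (rule directional_min_time_le[OF \<open>0 \<le> t\<close>])
  also have "\<dots> < ereal s"
    using \<open>t < s\<close> by simp
  finally show ?thesis .
qed

lemma strictly_convex_midpoint:
  assumes "strictly_convex \<Omega>" "p \<in> \<Omega>" "q \<in> \<Omega>" "p \<noteq> q"
  shows "midpoint p q \<in> interior \<Omega>"
proof -
  have "(1/2) *\<^sub>R p + (1 - 1/2) *\<^sub>R q \<in> interior \<Omega>"
    using assms(1)[unfolded strictly_convex_def, rule_format, OF assms(2-4), of "1/2"] by simp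
  then show ?thesis
    by (simp add: midpoint_def scaleR_add_right)
qed

lemma midpoint_add_scaleR:
  "midpoint (x + a *\<^sub>R v) (y + b *\<^sub>R v) = midpoint x y + ((a + b) / 2) *\<^sub>R v"
  by (simp add: midpoint_def algebra_simps add_divide_distrib)

lemma directional_min_time_midpoint_le:
  assumes "strictly_convex \<Omega>" "0 \<le> a" "0 \<le> b" "x + a *\<^sub>R v \<in> \<Omega>" "y + b *\<^sub>R v \<in> \<Omega>"
  shows "directional_min_time v \<Omega> (midpoint x y) \<le> ereal ((a + b) / 2)"
proof (rule directional_min_time_le)
  have "midpoint (x + a *\<^sub>R v) (y + b *\<^sub>R v) \<in> \<Omega>"
    \<comment> \<open>If the two hitting points coincide, strict convexity says nothing, but their
      midpoint is then that common point.\<close>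
    using strictly_convex_midpoint[OF assms(1,4,5)] interior_subset assms(4)
    by (cases "x + a *\<^sub>R v = y + b *\<^sub>R v") auto
  then show "midpoint x y + ((a + b) / 2) *\<^sub>R v \<in> \<Omega>"
    by (simp only: midpoint_add_scaleR)
qed (use assms in simp)

lemma directional_min_time_midpoint_less:
  assumes "strictly_convex \<Omega>" "0 \<le> a" "0 \<le> b" "x + a *\<^sub>R v \<in> \<Omega>" "y + b *\<^sub>R v \<in> \<Omega>"
    and "midpoint x y \<notin> \<Omega>" and "x - y \<notin> span {v}"
  shows "directional_min_time v \<Omega> (midpoint x y) < ereal ((a + b) / 2)"
proof (rule directional_min_time_less)
  have "x + a *\<^sub>R v \<noteq> y + b *\<^sub>R v"
  proof
    assume "x + a *\<^sub>R v = y + b *\<^sub>R v"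
    then have "x - y = (b - a) *\<^sub>R v"
      by (simp add: algebra_simps)
    then show False
      using assms(7) by (auto simp: span_singleton)
  qed
  from strictly_convex_midpoint[OF assms(1,4,5) this]
  show "midpoint x y + ((a + b) / 2) *\<^sub>R v \<in> interior \<Omega>"
    by (simp only: midpoint_add_scaleR)
qed (use assms in simp_all)

text \<open>A nonzero multiple of \<open>u\<close> in the span of \<open>w\<close> can be rescaled
  to put \<open>u\<close> itself there. Hence a nonzero \<open>x - y\<close> is parallel to at most
  one of two independent directions.\<close>

lemma lin_indep_pair_span_Int:
  assumes "lin_indep_pair u w" "z \<in> span {u}" "z \<in> span {w}"
  shows "z = 0"
proof (rule ccontr)
  assume "z \<noteq> 0"
  obtain c where c: "z = c *\<^sub>R u"
    using assms by (auto simp: span_singleton)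
  then have "u = (1 / c) *\<^sub>R z"
    using \<open>z \<noteq> 0\<close> by simp
  then have "u \<in> span {w}"
    using assms(3) by (simp add: span_scale)
  then show False
    using assms(1) by (simp add: lin_indep_pair_def independent_insert)
qed

lemma two_distinct_of_card:
  assumes "2 \<le> card A"
  obtains i j where "i \<in> A" "j \<in> A" "i \<noteq> j"
proof -
  obtain B where "B \<subseteq> A" "card B = 2"
    using obtain_subset_with_card_n[OF assms] by metis
  then show thesis
    using that by (auto simp: card_2_iff)
qed

theorem theorem5p2:
  fixes n :: nat
    and \<Omega>\<^sub>0 :: "'a::real_normed_vector set"
    and \<Omega> :: "nat \<Rightarrow> 'a set"
    and v :: "nat \<Rightarrow> 'a"
  assumes "n \<ge> 2"
    and "\<Omega>\<^sub>0 \<noteq> {}" and "closed \<Omega>\<^sub>0" and "convex \<Omega>\<^sub>0"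
    and "\<And>i. i \<in> {1..n} \<Longrightarrow> \<Omega> i \<noteq> {} \<and> closed (\<Omega> i) \<and> strictly_convex (\<Omega> i)"
    and "\<And>i. i \<in> {1..n} \<Longrightarrow> v i \<noteq> 0"
    and "\<And>x y. x \<in> \<Omega>\<^sub>0 \<Longrightarrow> y \<in> \<Omega>\<^sub>0 \<Longrightarrow> x \<noteq> y \<Longrightarrow>
           card {i \<in> {1..n}. closed_segment x y \<inter> \<Omega> i = {}} \<ge> 2"
    and "\<And>i j. i \<in> {1..n} \<Longrightarrow> j \<in> {1..n} \<Longrightarrow> i \<noteq> j \<Longrightarrow> lin_indep_pair (v i) (v j)"
  shows "\<exists>\<^sub>\<le>\<^sub>1 x. optimal_solution (\<lambda>x. \<Sum>i=1..n. directional_min_time (v i) (\<Omega> i) x) \<Omega>\<^sub>0 x"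
  unfolding Uniq_def
proof (intro allI impI, rule ccontr)
  let ?T = "\<lambda>i. directional_min_time (v i) (\<Omega> i)"
  let ?S = "\<lambda>x. \<Sum>i=1..n. ?T i x"
  fix x y
  assume optx: "optimal_solution ?S \<Omega>\<^sub>0 x" and opty: "optimal_solution ?S \<Omega>\<^sub>0 y" and "x \<noteq> y"
  have xy: "x \<in> \<Omega>\<^sub>0" "y \<in> \<Omega>\<^sub>0"
    using optx opty by (auto simp: optimal_solution_def)
  have hit: "\<exists>a. 0 \<le> a \<and> ?T i z = ereal a \<and> z + a *\<^sub>R v i \<in> \<Omega> i"
    if "optimal_solution ?S \<Omega>\<^sub>0 z" and i: "i \<in> {1..n}" for z i
  proof -
    have "?S z \<noteq> \<infinity>"
      using that by (simp add: optimal_solution_def)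
    \<comment> \<open>A single infinite term would make the whole sum infinite.\<close>
    then have "?T i z < \<infinity>"
      using i by (auto simp: sum_Pinfty)
    then show ?thesis
      using directional_min_time_attained assms(5)[OF i] by metis
  qed
  obtain a where a: "\<And>i. i \<in> {1..n} \<Longrightarrow> 0 \<le> a i \<and> ?T i x = ereal (a i) \<and> x + a i *\<^sub>R v i \<in> \<Omega> i"
    using hit[OF optx] by metis
  obtain b where b: "\<And>i. i \<in> {1..n} \<Longrightarrow> 0 \<le> b i \<and> ?T i y = ereal (b i) \<and> y + b i *\<^sub>R v i \<in> \<Omega> i"
    using hit[OF opty] by metis
  define m where "m = midpoint x y"
  have m: "m \<in> \<Omega>\<^sub>0" "m \<in> closed_segment x y"
    using closed_segment_subset[OF xy assms(4)] midpoint_in_closed_segment[of x y]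
    by (simp_all add: m_def subset_iff)
  have le: "?T i m \<le> ereal ((a i + b i) / 2)" if "i \<in> {1..n}" for i
    unfolding m_def using a[OF that] b[OF that] assms(5)[OF that]
    by (intro directional_min_time_midpoint_le) auto
  obtain k where k: "k \<in> {1..n}" "closed_segment x y \<inter> \<Omega> k = {}" "x - y \<notin> span {v k}"
  proof -
    obtain i j where ij: "i \<in> {1..n}" "j \<in> {1..n}" "i \<noteq> j"
      "closed_segment x y \<inter> \<Omega> i = {}" "closed_segment x y \<inter> \<Omega> j = {}"
      by (rule two_distinct_of_card[OF assms(7)[OF xy \<open>x \<noteq> y\<close>]]) blast
    have "x - y \<notin> span {v i} \<or> x - y \<notin> span {v j}"
      using lin_indep_pair_span_Int[OF assms(8)[OF ij(1-3)], of "x - y"] \<open>x \<noteq> y\<close> by fastforce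
    then show thesis
      using that ij by blast
  qed
  have "m \<notin> \<Omega> k"
    using k(2) m(2) by blast
  then have less: "?T k m < ereal ((a k + b k) / 2)"
    using a[OF k(1)] b[OF k(1)] assms(5)[OF k(1)] k(3) unfolding m_def
    by (intro directional_min_time_midpoint_less) simp_all
  \<comment> \<open>The values at \<open>m\<close> lie between 0 and a real bound. Passing to real
    sums lets one strict term make the sum strictly smaller.\<close>
  have "\<exists>d. ?T i m = ereal d" if "i \<in> {1..n}" for i
    using le[OF that] directional_min_time_nonneg[of "v i" "\<Omega> i" m] by (cases "?T i m") auto
  then obtain d where d: "\<And>i. i \<in> {1..n} \<Longrightarrow> ?T i m = ereal (d i)"
    by metis
  have "(\<Sum>i=1..n. d i) < (\<Sum>i=1..n. (a i + b i) / 2)"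
    using le less d k(1) by (intro sum_strict_mono_ex1) auto
  also have "\<dots> = ((\<Sum>i=1..n. a i) + (\<Sum>i=1..n. b i)) / 2"
    by (simp add: sum.distrib flip: sum_divide_distrib)
  finally have dab: "(\<Sum>i=1..n. d i) < ((\<Sum>i=1..n. a i) + (\<Sum>i=1..n. b i)) / 2" .
  have S: "?S z = ereal (\<Sum>i=1..n. c i)"
    if "\<And>i. i \<in> {1..n} \<Longrightarrow> ?T i z = ereal (c i)" for z c
    unfolding sum_ereal[symmetric] by (rule sum.cong[OF refl that])
  have Sx: "?S x = ereal (\<Sum>i=1..n. a i)" and Sy: "?S y = ereal (\<Sum>i=1..n. b i)"
    and Sm: "?S m = ereal (\<Sum>i=1..n. d i)"
    using a b d by (blast intro: S)+
  \<comment> \<open>Both optimal values are at most the value at \<open>m\<close>, hence so is their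
    average, against \<open>dab\<close>.\<close>
  have "?S x \<le> ?S m" "?S y \<le> ?S m"
    using optx opty m(1) by (auto simp: optimal_solution_def)
  then show False
    using dab unfolding Sx Sy Sm by simp
qed

end
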